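(* Let $\mathbf{A}\in\mathbb{R}^{m\times n}$, $\mathbf{B}\in\mathbb{R}^{n\times m}$, let $\mathbf{b}\in\mathbb{R}^m$, $\mathbf{c}\in\mathbb{R}^n$ be nonzero, let $\lambda,\mu\in\mathbb{R}$, and let $k\ge1$ be such that the simultaneous Hessenberg process with pivoting applied to $(\mathbf{A},\mathbf{B},\mathbf{b},\mathbf{c})$ does not terminate in its first $k$ steps. Let $\mathbf{r}_k^{\mathrm{GP\text{-}CMRH}}$ and $\mathbf{r}_k^{\mathrm{GPMR}}$ be the $k$th residuals of GP-CMRH and GPMR, respectively, for the linear system $$\begin{bmatrix}\lambda\mathbf{I}&\mathbf{A}\\ \mathbf{B}&\mu\mathbf{I}\end{bmatrix}\begin{bmatrix}\mathbf{x}\\ \mathbf{y}\end{bmatrix}=\begin{bmatrix}\mathbf{b}\\ \mathbf{c}\end{bmatrix}$$ (all defined in the context). Then $$\|\mathbf{r}_k^{\mathrm{GPMR}}\|\le\|\mathbf{r}_k^{\mathrm{GP\text{-}CMRH}}\|\le\kappa(\mathbf{W}_{k+1})\,\|\mathbf{r}_k^{\mathrm{GPMR}}\|,$$ where $\kappa(\mathbf{W}_{k+1})=\|\mathbf{W}_{k+1}\|\,\|\mathbf{W}_{k+1}^\dagger\|$ is the condition number of $\mathbf{W}_{k+1}$.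
   Context: Notation. $\|\cdot\|$ is the Euclidean norm of a vector and the spectral norm of a matrix; $\dagger$ is the Moore–Penrose inverse; $\mathbf{e}_i$ is the $i$th standard basis vector of the size clear from context; $\mathbf{d}(i)$ is the $i$th entry of a vector $\mathbf{d}$. Simultaneous Hessenberg process with pivoting. Start with $\mathbf{p}=(1,2,\dots,m)$, $\mathbf{q}=(1,2,\dots,n)$. Choose $i_0$, $j_0$ maximizing $|\mathbf{b}(i)|$ over $1\le i\le m$ and $|\mathbf{c}(j)|$ over $1\le j\le n$; set $\beta=\mathbf{b}(i_0)$, $\mathbf{d}_1=\mathbf{b}/\beta$, $\gamma=\mathbf{c}(j_0)$, $\boldsymbol{\ell}_1=\mathbf{c}/\gamma$; swap $\mathbf{p}(1)$ with $\mathbf{p}(i_0)$ and $\mathbf{q}(1)$ with $\mathbf{q}(j_0)$. For $s=1,2,\dots$: set $\mathbf{d}=\mathbf{A}\boldsymbol{\ell}_s$, $\boldsymbol{\ell}=\mathbf{B}\mathbf{d}_s$; for $i=1,\dots,s$ successively set $h_{i,s}=\mathbf{d}(\mathbf{p}(i))$, $f_{i,s}=\boldsymbol{\ell}(\mathbf{q}(i))$, and replace $\mathbf{d}$ by $\mathbf{d}-h_{i,s}\mathbf{d}_i$ and $\boldsymbol{\ell}$ by $\boldsymbol{\ell}-f_{i,s}\boldsymbol{\ell}_i$; then choose $i_0\in\{s+1,\dots,m\}$ maximizing $|\mathbf{d}(\mathbf{p}(i))|$ and $j_0\in\{s+1,\dots,n\}$ maximizing $|\boldsymbol{\ell}(\mathbf{q}(j))|$;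 set $h_{s+1,s}=\mathbf{d}(\mathbf{p}(i_0))$, $f_{s+1,s}=\boldsymbol{\ell}(\mathbf{q}(j_0))$, $\mathbf{d}_{s+1}=\mathbf{d}/h_{s+1,s}$, $\boldsymbol{\ell}_{s+1}=\boldsymbol{\ell}/f_{s+1,s}$; swap $\mathbf{p}(s+1)$ with $\mathbf{p}(i_0)$ and $\mathbf{q}(s+1)$ with $\mathbf{q}(j_0)$. The process terminates at step $s$ if $h_{s+1,s}=0$ or $f_{s+1,s}=0$; "does not terminate in its first $k$ steps" means $k+1\le\min\{m,n\}$ and $h_{s+1,s}\ne0$, $f_{s+1,s}\neq0$ for $s=1,\dots,k$. Write $\mathbf{D}_j=[\mathbf{d}_1\ \cdots\ \mathbf{d}_j]$ and $\mathbf{L}_j=[\boldsymbol{\ell}_1\ \cdots\ \boldsymbol{\ell}_j]$. Block basis. For $j\in\{k,k+1\}$, let $$\mathbf{W}_j=\begin{bmatrix}\mathbf{d}_1&\mathbf{0}&\mathbf{d}_2&\mathbf{0}&\cdots&\mathbf{d}_j&\mathbf{0}\\ \mathbf{0}&\boldsymbol{\ell}_1&\mathbf{0}&\boldsymbol{\ell}_2&\cdots&\mathbf{0}&\boldsymbol{\ell}_j\end{bmatrix}\in\mathbb{R}^{(m+n)\times 2j},$$ i.e. the block diagonal matrix $\mathrm{blkdiag}(\mathbf{D}_j,\mathbf{L}_j)$ with its columns reordered. Projected matrix. $\mathbf{S}_{k+1,k}\in\mathbb{R}^{(2k+2)\times 2k}$ is the block upper Hessenberg matrix made of $2\times2$ blocks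 whose $(i,j)$ block ($1\le i\le k+1$, $1\le j\le k$) is $\begin{bmatrix}0&h_{i,j}\\ f_{i,j}&0\end{bmatrix}$ if $i\le j+1$ and $i\neq j$, is $\begin{bmatrix}\lambda&h_{j,j}\\ f_{j,j}&\mu\end{bmatrix}$ if $i=j$, and is $\mathbf{0}$ if $i>j+1$. With $\mathbf{K}=\begin{bmatrix}\lambda\mathbf{I}&\mathbf{A}\\ \mathbf{B}&\mu\mathbf{I}\end{bmatrix}$ and $\mathbf{g}=\begin{bmatrix}\mathbf{b}\\ \mathbf{c}\end{bmatrix}$, one has $\mathbf{K}\mathbf{W}_k=\mathbf{W}_{k+1}\mathbf{S}_{k+1,k}$ and $\mathbf{g}=\mathbf{W}_{k+1}(\beta\mathbf{e}_1+\gamma\mathbf{e}_2)$. The two methods. The $k$th GP-CMRH iterate is $\mathbf{W}_k\mathbf{z}_k^{\mathrm{GP\text{-}CMRH}}$, where $\mathbf{z}_k^{\mathrm{GP\text{-}CMRH}}\in\mathbb{R}^{2k}$ is a minimizer over $\mathbf{z}\in\mathbb{R}^{2k}$ of $\|\beta\mathbf{e}_1+\gamma\mathbf{e}_2-\mathbf{S}_{k+1,k}\mathbf{z}\|$; its residual is $\mathbf{r}_k^{\mathrm{GP\text{-}CMRH}}=\mathbf{g}-\mathbf{K}\mathbf{W}_k\mathbf{z}_k^{\mathrm{GP\text{-}CMRH}}$. The $k$th GPMR iterate is the approximate solution in $\mathrm{range}(\mathbf{W}_k)$ minimizing the residual norm, i.e. $\mathbf{W}_k\mathbf{z}_k^{\mathrm{GPMR}}$,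 where $\mathbf{z}_k^{\mathrm{GPMR}}\in\mathbb{R}^{2k}$ is a minimizer over $\mathbf{z}\in\mathbb{R}^{2k}$ of $\|\mathbf{g}-\mathbf{K}\mathbf{W}_k\mathbf{z}\|$; its residual is $\mathbf{r}_k^{\mathrm{GPMR}}=\mathbf{g}-\mathbf{K}\mathbf{W}_k\mathbf{z}_k^{\mathrm{GPMR}}$. *)

theory Defs
  imports Complex_Main "Jordan_Normal_Form.Matrix"
begin

definition vnorm :: "real vec \<Rightarrow> real" where
  "vnorm v = sqrt (v \<bullet> v)"

(* The unit ball rather than the unit sphere, so that the supremum is also over a
   nonempty set when A has no columns. *)
definition spectral_norm :: "real mat \<Rightarrow> real" where
  "spectral_norm A = Sup {vnorm (A *\<^sub>v v) | v. v \<in> carrier_vec (dim_col A) \<and> vnorm v \<le> 1}"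

definition is_moore_penrose :: "real mat \<Rightarrow> real mat \<Rightarrow> bool" where
  "is_moore_penrose A X \<longleftrightarrow>
     X \<in> carrier_mat (dim_col A) (dim_row A) \<and>
     A * X * A = A \<and> X * A * X = X \<and>
     transpose_mat (A * X) = A * X \<and> transpose_mat (X * A) = X * A"

definition pinv :: "real mat \<Rightarrow> real mat" where
  "pinv A = (THE X. is_moore_penrose A X)"

definition cond_number :: "real mat \<Rightarrow> real" where
  "cond_number A = spectral_norm A * spectral_norm (pinv A)"

(* The simultaneous Hessenberg process with pivoting. All indices (vector entries, positions
   in the permutations p and q, basis vectors, steps, and rows and columns of h and f) start
   at 0, so each is one less than in the usual 1-based presentation.

   p s and q s are the permutations at the beginning of step s (after the initial swap and
   s further swaps). Ties in the pivot search may be broken arbitrarily, so the process is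
   given as a relation between the data and the computed quantities. *)

definition is_pivot :: "nat \<Rightarrow> nat \<Rightarrow> (nat \<Rightarrow> nat) \<Rightarrow> real vec \<Rightarrow> nat \<Rightarrow> bool" where
  "is_pivot N s p v i0 \<longleftrightarrow> i0 \<in> {s..<N} \<and> (\<forall>i\<in>{s..<N}. \<bar>v $ p i\<bar> \<le> \<bar>v $ p i0\<bar>)"

definition swap_entries :: "(nat \<Rightarrow> nat) \<Rightarrow> nat \<Rightarrow> nat \<Rightarrow> nat \<Rightarrow> nat" where
  "swap_entries p i j = p(i := p j, j := p i)"

definition hess_init :: "nat \<Rightarrow> real vec \<Rightarrow> real \<Rightarrow> real vec \<Rightarrow> (nat \<Rightarrow> nat) \<Rightarrow> bool" where
  "hess_init N b \<beta> d p \<longleftrightarrow>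
     (\<exists>i0. is_pivot N 0 id b i0 \<and> \<beta> = b $ i0 \<and> d = (1 / \<beta>) \<cdot>\<^sub>v b \<and> p = swap_entries id 0 i0)"

(* The vector v after the first i elimination updates. *)
primrec hess_elim :: "(nat \<Rightarrow> real vec) \<Rightarrow> (nat \<Rightarrow> nat) \<Rightarrow> real vec \<Rightarrow> nat \<Rightarrow> real vec" where
  "hess_elim d p v 0 = v"
| "hess_elim d p v (Suc i) = hess_elim d p v i - (hess_elim d p v i $ p i) \<cdot>\<^sub>v d i"

(* Step s on one of the two sides: v is the vector to be reduced (A applied to the s-th
   vector l, or B applied to the s-th vector d), h is column s of the coefficients, and p, p'
   are the permutations before and after the step. *)
definition hess_step ::
    "nat \<Rightarrow> nat \<Rightarrow> real vec \<Rightarrow> (nat \<Rightarrow> real vec) \<Rightarrow> (nat \<Rightarrow> real) \<Rightarrow> (nat \<Rightarrow> nat) \<Rightarrow> (nat \<Rightarrow> nat) \<Rightarrow> bool"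
  where
  "hess_step N s v d h p p' \<longleftrightarrow>
     (\<forall>i\<le>s. h i = hess_elim d p v i $ p i) \<and>
     (let w = hess_elim d p v (Suc s) in
       \<exists>i0. is_pivot N (Suc s) p w i0 \<and>
            h (Suc s) = w $ p i0 \<and>
            d (Suc s) = (1 / h (Suc s)) \<cdot>\<^sub>v w \<and>
            p' = swap_entries p (Suc s) i0)"

definition simultaneous_hessenberg ::
    "real mat \<Rightarrow> real mat \<Rightarrow> real vec \<Rightarrow> real vec \<Rightarrow> nat \<Rightarrow> real \<Rightarrow> real \<Rightarrow>
     (nat \<Rightarrow> nat \<Rightarrow> nat) \<Rightarrow> (nat \<Rightarrow> nat \<Rightarrow> nat) \<Rightarrow> (nat \<Rightarrow> real vec) \<Rightarrow> (nat \<Rightarrow> real vec) \<Rightarrow>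
     (nat \<Rightarrow> nat \<Rightarrow> real) \<Rightarrow> (nat \<Rightarrow> nat \<Rightarrow> real) \<Rightarrow> bool"
  where
  "simultaneous_hessenberg A B b c k \<beta> \<gamma> p q d l h f \<longleftrightarrow>
     hess_init (dim_vec b) b \<beta> (d 0) (p 0) \<and>
     hess_init (dim_vec c) c \<gamma> (l 0) (q 0) \<and>
     (\<forall>s<k. hess_step (dim_vec b) s (A *\<^sub>v l s) d (\<lambda>i. h i s) (p s) (p (Suc s)) \<and>
            hess_step (dim_vec c) s (B *\<^sub>v d s) l (\<lambda>i. f i s) (q s) (q (Suc s)))"

definition not_terminated ::
    "nat \<Rightarrow> nat \<Rightarrow> nat \<Rightarrow> (nat \<Rightarrow> nat \<Rightarrow> real) \<Rightarrow> (nat \<Rightarrow> nat \<Rightarrow> real) \<Rightarrow> bool"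
  where
  "not_terminated m n k h f \<longleftrightarrow>
     k + 1 \<le> min m n \<and> (\<forall>s<k. h (Suc s) s \<noteq> 0 \<and> f (Suc s) s \<noteq> 0)"

definition W_mat :: "nat \<Rightarrow> nat \<Rightarrow> (nat \<Rightarrow> real vec) \<Rightarrow> (nat \<Rightarrow> real vec) \<Rightarrow> nat \<Rightarrow> real mat" where
  "W_mat m n d l j =
     mat_of_cols (m + n)
       (map (\<lambda>i. if even i then d (i div 2) @\<^sub>v 0\<^sub>v n else 0\<^sub>v m @\<^sub>v l (i div 2)) [0..<2 * j])"

definition S_mat ::
    "real \<Rightarrow> real \<Rightarrow> (nat \<Rightarrow> nat \<Rightarrow> real) \<Rightarrow> (nat \<Rightarrow> nat \<Rightarrow> real) \<Rightarrow> nat \<Rightarrow> real mat"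
  where
  "S_mat lam mu h f k = mat (2 * k + 2) (2 * k) (\<lambda>(r, t).
     let i = r div 2; j = t div 2 in
     if i > j + 1 then 0
     else if even r \<and> even t then (if i = j then lam else 0)
     else if even r \<and> odd t then h i j
     else if odd r \<and> even t then f i j
     else (if i = j then mu else 0))"

definition K_mat :: "real \<Rightarrow> real \<Rightarrow> real mat \<Rightarrow> real mat \<Rightarrow> real mat" where
  "K_mat lam mu A B =
     four_block_mat (lam \<cdot>\<^sub>m 1\<^sub>m (dim_row A)) A B (mu \<cdot>\<^sub>m 1\<^sub>m (dim_row B))"

definition is_gpcmrh_residual ::
    "real mat \<Rightarrow> real vec \<Rightarrow> real mat \<Rightarrow> real mat \<Rightarrow> real \<Rightarrow> real \<Rightarrow> nat \<Rightarrow> real vec \<Rightarrow> bool"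
  where
  "is_gpcmrh_residual K g W S \<beta> \<gamma> k r \<longleftrightarrow>
     (\<exists>z. is_arg_min
            (\<lambda>z. vnorm (\<beta> \<cdot>\<^sub>v unit_vec (2 * k + 2) 0 + \<gamma> \<cdot>\<^sub>v unit_vec (2 * k + 2) 1 - S *\<^sub>v z))
            (\<lambda>z. z \<in> carrier_vec (2 * k)) z \<and>
          r = g - K *\<^sub>v (W *\<^sub>v z))"

definition is_gpmr_residual ::
    "real mat \<Rightarrow> real vec \<Rightarrow> real mat \<Rightarrow> nat \<Rightarrow> real vec \<Rightarrow> bool"
  where
  "is_gpmr_residual K g W k r \<longleftrightarrow>
     (\<exists>z. is_arg_min (\<lambda>z. vnorm (g - K *\<^sub>v (W *\<^sub>v z))) (\<lambda>z. z \<in> carrier_vec (2 * k)) z \<and>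
          r = g - K *\<^sub>v (W *\<^sub>v z))"

end

theory Submission
  imports Defs "Jordan_Normal_Form.Determinant" "HOL-Analysis.L2_Norm"
begin

text \<open>
  Write \<open>W\<close> for the block basis \<open>W\<^bsub>k+1\<^esub>\<close>, \<open>S\<close> for the projected matrix and
  \<open>e = \<beta> e\<^sub>1 + \<gamma> e\<^sub>2\<close>. The relations \<open>K W\<^sub>k = W S\<close> and \<open>g = W e\<close> turn the residual that
  belongs to a coefficient vector \<open>z\<close> into \<open>g - K W\<^sub>k z = W (e - S z)\<close>. GPMR minimizes the
  norm of this vector over \<open>z\<close>, so its residual is at most that of GP-CMRH, whereas GP-CMRH
  minimizes the norm of \<open>e - S z\<close> alone. Let \<open>x\<close> and \<open>y\<close> be the values of \<open>e - S z\<close> for the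
  GP-CMRH and the GPMR minimizer, so that \<open>x\<close> is no longer than \<open>y\<close>. Since \<open>W\<close> has full
  column rank, its pseudoinverse is a left inverse, and
  \<open>\<parallel>W x\<parallel> \<le> \<parallel>W\<parallel> \<parallel>x\<parallel> \<le> \<parallel>W\<parallel> \<parallel>y\<parallel> = \<parallel>W\<parallel> \<parallel>W\<^sup>\<dagger> W y\<parallel> \<le> \<kappa>(W) \<parallel>W y\<parallel>\<close>.
  This is \<open>quasi_minimal_residual_bound\<close>.

  Full column rank comes from the pivoting. Elimination makes each new vector vanish at all
  earlier pivot positions, and the scaling makes it equal to \<open>1\<close> at its own. Read at the pivot
  positions, the vectors of either side therefore form a unit lower triangular matrix
  (\<open>hessenberg_pivoted\<close>), and such families are linearly independent
  (\<open>pivoted_family_independent\<close>). The same analysis of the elimination expresses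
  \<open>A l\<^sub>s\<close> and \<open>B d\<^sub>s\<close> in the two families, which is what \<open>K W\<^sub>k = W S\<close> says column by column
  (\<open>K_W_eq_W_S\<close>).
\<close>

section \<open>Euclidean and spectral norm\<close>

lemma vnorm_eq_L2_set: "vnorm v = L2_set (\<lambda>i. v $ i) {..<dim_vec v}"
  by (simp add: vnorm_def L2_set_def scalar_prod_def power2_eq_square lessThan_atLeast0)

lemma vnorm_nonneg: "0 \<le> vnorm v"
  by (simp add: vnorm_eq_L2_set L2_set_nonneg)

lemma vnorm_zero_vec: "vnorm (0\<^sub>v N) = 0"
  by (simp add: vnorm_def)

lemma vnorm_eq_0_iff: "v \<in> carrier_vec N \<Longrightarrow> vnorm v = 0 \<longleftrightarrow> v = 0\<^sub>v N"
  by (auto simp: vnorm_eq_L2_set L2_set_eq_0_iff)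

lemma vnorm_smult: "vnorm (a \<cdot>\<^sub>v v) = \<bar>a\<bar> * vnorm v"
  by (simp add: vnorm_def real_sqrt_mult flip: mult.assoc)

text \<open>
  The spectral norm is a supremum of reals, which says something about its elements only if they
  are bounded. A crude bound is enough: the entries of a vector in the unit ball are at most \<open>1\<close>
  in modulus, so the sum of the moduli of all matrix entries bounds the norm of the image.
\<close>

lemma bdd_above_image_unit_ball:
  "bdd_above {vnorm (A *\<^sub>v v) | v. v \<in> carrier_vec (dim_col A) \<and> vnorm v \<le> 1}"
proof (rule bdd_aboveI)
  fix y
  assume "y \<in> {vnorm (A *\<^sub>v v) | v. v \<in> carrier_vec (dim_col A) \<and> vnorm v \<le> 1}"
  then obtain v where y: "y = vnorm (A *\<^sub>v v)" and v: "v \<in> carrier_vec (dim_col A)"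
    and le: "vnorm v \<le> 1"
    by auto
  have entry: "\<bar>v $ j\<bar> \<le> 1" if "j < dim_col A" for j
  proof -
    have "\<bar>v $ j\<bar> = L2_set (\<lambda>i. v $ i) {j}"
      by simp
    also have "\<dots> \<le> vnorm v"
      unfolding vnorm_eq_L2_set L2_set_def using that v
      by (intro real_sqrt_le_mono sum_mono2) auto
    finally show ?thesis using le by simp
  qed
  have "y \<le> (\<Sum>i<dim_row A. \<bar>(A *\<^sub>v v) $ i\<bar>)"
    unfolding y vnorm_eq_L2_set dim_mult_mat_vec by (rule L2_set_le_sum_abs)
  also have "\<dots> \<le> (\<Sum>i<dim_row A. \<Sum>j<dim_col A. \<bar>A $$ (i, j)\<bar>)"
  proof (rule sum_mono)
    fix i
    assume "i \<in> {..<dim_row A}"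
    then have "\<bar>(A *\<^sub>v v) $ i\<bar> = \<bar>\<Sum>j<dim_col A. A $$ (i, j) * v $ j\<bar>"
      using v by (simp add: scalar_prod_def lessThan_atLeast0)
    also have "\<dots> \<le> (\<Sum>j<dim_col A. \<bar>A $$ (i, j) * v $ j\<bar>)"
      by (rule sum_abs)
    also have "\<dots> \<le> (\<Sum>j<dim_col A. \<bar>A $$ (i, j)\<bar>)"
      using entry by (intro sum_mono) (simp add: abs_mult mult_left_le)
    finally show "\<bar>(A *\<^sub>v v) $ i\<bar> \<le> (\<Sum>j<dim_col A. \<bar>A $$ (i, j)\<bar>)" .
  qed
  finally show "y \<le> (\<Sum>i<dim_row A. \<Sum>j<dim_col A. \<bar>A $$ (i, j)\<bar>)" .
qed

lemma vnorm_mult_le_spectral_norm_unit: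
  assumes "v \<in> carrier_vec (dim_col A)" "vnorm v \<le> 1"
  shows "vnorm (A *\<^sub>v v) \<le> spectral_norm A"
  unfolding spectral_norm_def using assms by (intro cSup_upper bdd_above_image_unit_ball) auto

lemma spectral_norm_nonneg: "0 \<le> spectral_norm A"
  using vnorm_mult_le_spectral_norm_unit[of "0\<^sub>v (dim_col A)" A] vnorm_nonneg[of "A *\<^sub>v 0\<^sub>v (dim_col A)"]
  by (simp add: vnorm_zero_vec)

lemma vnorm_mult_mat_vec_le:
  assumes v: "v \<in> carrier_vec (dim_col A)"
  shows "vnorm (A *\<^sub>v v) \<le> spectral_norm A * vnorm v"
proof (cases "vnorm v = 0")
  case True
  then have "v = 0\<^sub>v (dim_col A)" using v by (simp add: vnorm_eq_0_iff)
  then have "A *\<^sub>v v = 0\<^sub>v (dim_row A)" by auto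
  then show ?thesis using True by (simp add: vnorm_zero_vec)
next
  case False
  then have pos: "vnorm v > 0" using vnorm_nonneg[of v] by simp
  let ?u = "(1 / vnorm v) \<cdot>\<^sub>v v"
  have "vnorm (A *\<^sub>v ?u) \<le> spectral_norm A"
    using v pos by (intro vnorm_mult_le_spectral_norm_unit) (auto simp: vnorm_smult)
  moreover have "A *\<^sub>v ?u = (1 / vnorm v) \<cdot>\<^sub>v (A *\<^sub>v v)"
    using v by (intro mult_mat_vec[of _ "dim_row A" "dim_col A"]) auto
  ultimately show ?thesis
    using pos by (simp add: vnorm_smult field_simps)
qed

section \<open>The pseudoinverse of a matrix of full column rank\<close>

text \<open>
  A vector in the kernel of \<open>A\<^sup>T A\<close> is already in the kernel of \<open>A\<close>, because
  \<open>\<parallel>A x\<parallel>\<^sup>2 = (A\<^sup>T A x) \<bullet> x\<close>.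
\<close>

lemma gram_det_nonzero:
  fixes A :: "real mat"
  assumes A: "A \<in> carrier_mat N M"
    and inj: "\<And>x. x \<in> carrier_vec M \<Longrightarrow> A *\<^sub>v x = 0\<^sub>v N \<Longrightarrow> x = 0\<^sub>v M"
  shows "det (A\<^sup>T * A) \<noteq> 0"
proof
  assume "det (A\<^sup>T * A) = 0"
  moreover have G: "A\<^sup>T * A \<in> carrier_mat M M" using A by auto
  ultimately obtain x where x: "x \<in> carrier_vec M" "x \<noteq> 0\<^sub>v M" "(A\<^sup>T * A) *\<^sub>v x = 0\<^sub>v M"
    using det_0_iff_vec_prod_zero_field by blast
  have Ax: "A *\<^sub>v x \<in> carrier_vec N" using A x by auto
  have "(A *\<^sub>v x) \<bullet> (A *\<^sub>v x) = ((A\<^sup>T *\<^sub>v (A *\<^sub>v x)) \<bullet> x)"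
    using A Ax x(1) by (intro transpose_vec_mult_scalar[symmetric]) auto
  also have "A\<^sup>T *\<^sub>v (A *\<^sub>v x) = 0\<^sub>v M"
    using A x by (subst assoc_mult_mat_vec[symmetric]) auto
  finally have "vnorm (A *\<^sub>v x) = 0" using x(1) by (simp add: vnorm_def)
  then have "A *\<^sub>v x = 0\<^sub>v N" using Ax by (simp add: vnorm_eq_0_iff)
  then show False using inj x by blast
qed

text \<open>
  For an injective \<open>A\<close> the matrix \<open>X = (A\<^sup>T A)\<^bsup>-1\<^esup> A\<^sup>T\<close> is a left inverse, and \<open>A X\<close> is
  symmetric since the inverse of a symmetric matrix is, so \<open>X\<close> satisfies the Penrose equations.
  The pseudoinverse is introduced by a definite description, hence identifying it with \<open>X\<close>
  also requires uniqueness. If \<open>Y\<close> is another solution, then \<open>A X = (A Y) (A X)\<close>; transposing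
  this product of symmetric matrices gives \<open>A X = (A X) (A Y) = A Y\<close>, and \<open>A\<close> can be cancelled
  on the left with \<open>X\<close>.
\<close>

lemma pinv_left_inverse:
  fixes A :: "real mat"
  assumes A: "A \<in> carrier_mat N M"
    and inj: "\<And>x. x \<in> carrier_vec M \<Longrightarrow> A *\<^sub>v x = 0\<^sub>v N \<Longrightarrow> x = 0\<^sub>v M"
  shows "pinv A \<in> carrier_mat M N" and "pinv A * A = 1\<^sub>m M"
proof -
  let ?G = "A\<^sup>T * A"
  have G: "?G \<in> carrier_mat M M" using A by auto
  have Gt: "?G\<^sup>T = ?G" using A by (subst transpose_mult) auto
  obtain H where H: "H \<in> carrier_mat M M" and HG: "H * ?G = 1\<^sub>m M" and GH: "?G * H = 1\<^sub>m M"
    using det_non_zero_imp_unit[OF G gram_det_nonzero[OF A inj], of "()"]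
    unfolding Units_def ring_mat_def by auto
  have Ht: "H\<^sup>T = H"
  proof -
    have "H\<^sup>T * ?G = 1\<^sub>m M"
      using arg_cong[OF GH, of transpose_mat] G H Gt by (simp add: transpose_mult[OF G H])
    then have "H\<^sup>T * ?G * H = H" using H by simp
    moreover have "H\<^sup>T * ?G * H = H\<^sup>T * (?G * H)"
      using G H by (intro assoc_mult_mat) auto
    ultimately show ?thesis using GH H by simp
  qed
  define X where "X = H * A\<^sup>T"
  have X: "X \<in> carrier_mat M N" using H A by (auto simp: X_def)
  have XA: "X * A = 1\<^sub>m M"
    using A H HG by (simp add: X_def assoc_mult_mat[of H M M "A\<^sup>T" N A M])
  have AXt: "(A * X)\<^sup>T = A * X"
  proof -
    have "(A * X)\<^sup>T = X\<^sup>T * A\<^sup>T" using A X by (rule transpose_mult)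
    also have "X\<^sup>T = A * H" unfolding X_def using A H Ht by (subst transpose_mult) auto
    also have "A * H * A\<^sup>T = A * X" unfolding X_def using A H by (intro assoc_mult_mat) auto
    finally show ?thesis .
  qed
  have mp: "is_moore_penrose A X"
    using A X XA AXt by (auto simp: is_moore_penrose_def assoc_mult_mat[OF A X A] assoc_mult_mat[OF X A X])
  have unique: "Y = X" if Y_mp: "is_moore_penrose A Y" for Y
  proof -
    have Y: "Y \<in> carrier_mat M N" and AYA: "A * Y * A = A" and AYt: "(A * Y)\<^sup>T = A * Y"
      using Y_mp A unfolding is_moore_penrose_def by auto
    have AY: "A * Y \<in> carrier_mat N N" and AX: "A * X \<in> carrier_mat N N" using A X Y by auto
    have "A * X = A * Y * A * X" by (simp add: AYA)
    also have "\<dots> = (A * Y) * (A * X)" using AY A X by (intro assoc_mult_mat)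
    finally have "A * X = (A * Y) * (A * X)" .
    then have "(A * X)\<^sup>T = (A * X)\<^sup>T * (A * Y)\<^sup>T"
      using transpose_mult[OF AY AX] by simp
    then have "A * X = (A * X) * (A * Y)" by (simp add: AXt AYt)
    also have "\<dots> = A * (X * A) * Y"
      using assoc_mult_mat[OF AX A Y] assoc_mult_mat[OF A X A] by simp
    also have "\<dots> = A * Y" using A XA by simp
    finally have "A * X = A * Y" .
    then have "X * A * X = X * A * Y" using A X Y by (simp add: assoc_mult_mat[OF X A])
    then show ?thesis using XA X Y by simp
  qed
  have "pinv A = X" unfolding pinv_def using mp unique by (rule the_equality)
  then show "pinv A \<in> carrier_mat M N" and "pinv A * A = 1\<^sub>m M" using X XA by auto
qed

section \<open>Families in pivoted echelon form\<close>

text \<open>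
  With rows taken in the order \<open>p 0, p 1, \<dots>\<close>, the matrix with columns \<open>d 0, \<dots>, d (j - 1)\<close> is
  unit lower triangular in its leading block of size \<open>j\<close>. The map \<open>p\<close> stands for the permutation
  built up by the pivot search. That it preserves the whole index range, and not only that its
  first \<open>j\<close> values are indices, keeps later pivot candidates inside the vectors.
\<close>

definition pivoted_family :: "nat \<Rightarrow> nat \<Rightarrow> (nat \<Rightarrow> real vec) \<Rightarrow> (nat \<Rightarrow> nat) \<Rightarrow> bool" where
  "pivoted_family N j d p \<longleftrightarrow>
     (\<forall>i<N. p i < N) \<and> j \<le> N \<and>
     (\<forall>i<j. d i \<in> carrier_vec N \<and> d i $ p i = 1 \<and> (\<forall>i'. i < i' \<and> i' < j \<longrightarrow> d i' $ p i = 0))"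

text \<open>
  Forward substitution: at position \<open>p i\<close> a combination with vanishing earlier coefficients
  takes the value \<open>a i\<close>.
\<close>

lemma pivoted_family_independent:
  assumes piv: "pivoted_family N j d p"
    and zero: "\<And>r. r < N \<Longrightarrow> (\<Sum>i<j. d i $ r * a i) = 0"
    and "i < j"
  shows "a i = 0"
  using \<open>i < j\<close>
proof (induction i rule: less_induct)
  case (less i)
  have "p i < N" using piv less.prems by (auto simp: pivoted_family_def)
  then have "0 = (\<Sum>i'<j. d i' $ p i * a i')" using zero by simp
  also have "\<dots> = (\<Sum>i'<j. if i' = i then a i else 0)"
  proof (rule sum.cong)
    fix i'
    assume "i' \<in> {..<j}"
    then show "d i' $ p i * a i' = (if i' = i then a i else 0)"
      using piv less by (cases i' i rule: linorder_cases) (auto simp: pivoted_family_def)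
  qed simp
  also have "\<dots> = a i" using less.prems by simp
  finally show ?case by simp
qed

section \<open>The Hessenberg process\<close>

text \<open>
  The largest entry of a nonzero vector is nonzero, so the initial scaling divides by a genuine
  pivot.
\<close>

lemma hess_init_pivoted:
  assumes init: "hess_init N b \<beta> (d 0) p" and b: "b \<in> carrier_vec N" "b \<noteq> 0\<^sub>v N"
  shows "pivoted_family N 1 d p" and "\<beta> \<cdot>\<^sub>v d 0 = b"
proof -
  obtain i0 where i0: "i0 < N" and max: "\<And>i. i < N \<Longrightarrow> \<bar>b $ i\<bar> \<le> \<bar>b $ i0\<bar>"
    and \<beta>: "\<beta> = b $ i0" and d0: "d 0 = (1 / \<beta>) \<cdot>\<^sub>v b" and p: "p = swap_entries id 0 i0"
    using init by (auto simp: hess_init_def is_pivot_def)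
  have "\<beta> \<noteq> 0"
  proof
    assume "\<beta> = 0"
    then have "b = 0\<^sub>v N" using max b(1) \<beta> by (intro eq_vecI) auto
    then show False using b(2) by simp
  qed
  then show "pivoted_family N 1 d p"
    using i0 b(1) \<beta> d0 p by (auto simp: pivoted_family_def swap_entries_def)
  show "\<beta> \<cdot>\<^sub>v d 0 = b" using \<open>\<beta> \<noteq> 0\<close> d0 by (simp add: smult_smult_assoc)
qed

text \<open>
  Update \<open>i\<close> clears the entry at \<open>p i\<close>, because \<open>d i\<close> is \<open>1\<close> there. Later updates keep it
  clear, because they subtract multiples of vectors that vanish at \<open>p i\<close>. Adding up the
  subtracted multiples recovers the original vector.
\<close>

lemma hess_elim_pivoted:
  assumes piv: "pivoted_family N j d p" and v: "v \<in> carrier_vec N" and "t \<le> j"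
  shows "hess_elim d p v t \<in> carrier_vec N \<and>
    (\<forall>i<t. hess_elim d p v t $ p i = 0) \<and>
    (\<forall>r<N. v $ r = hess_elim d p v t $ r + (\<Sum>i<t. hess_elim d p v i $ p i * d i $ r))"
  using \<open>t \<le> j\<close>
proof (induction t)
  case 0
  show ?case using v by simp
next
  case (Suc t)
  have d: "d t \<in> carrier_vec N" "d t $ p t = 1" and p: "\<And>i. i < j \<Longrightarrow> p i < N"
    and z: "\<And>i. i < t \<Longrightarrow> d t $ p i = 0"
    using piv Suc.prems by (auto simp: pivoted_family_def)
  show ?case using Suc d z p by (auto simp: less_Suc_eq)
qed

text \<open>
  The swap affects only positions from \<open>Suc s\<close> on, so the earlier pivot positions, and with them
  the triangular shape, survive the step; the new vector is scaled to \<open>1\<close> at the new pivot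
  position. Undoing the scaling in the decomposition given by the elimination yields column
  \<open>s\<close> of the Hessenberg relation.
\<close>

lemma hess_step_pivoted:
  assumes piv: "pivoted_family N (Suc s) d p" and step: "hess_step N s v d h p p'"
    and v: "v \<in> carrier_vec N" and h: "h (Suc s) \<noteq> 0"
  shows "pivoted_family N (Suc (Suc s)) d p'"
    and "r < N \<Longrightarrow> v $ r = (\<Sum>i<Suc (Suc s). d i $ r * h i)"
proof -
  define w where "w = hess_elim d p v (Suc s)"
  obtain i0 where i0: "Suc s \<le> i0" "i0 < N" and hS: "h (Suc s) = w $ p i0"
    and dS: "d (Suc s) = (1 / h (Suc s)) \<cdot>\<^sub>v w" and p': "p' = swap_entries p (Suc s) i0"
    and hi: "\<And>i. i \<le> s \<Longrightarrow> h i = hess_elim d p v i $ p i"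
    using step unfolding hess_step_def is_pivot_def Let_def w_def by auto
  have elim: "w \<in> carrier_vec N" "\<And>i. i < Suc s \<Longrightarrow> w $ p i = 0"
    "\<And>r. r < N \<Longrightarrow> v $ r = w $ r + (\<Sum>i<Suc s. hess_elim d p v i $ p i * d i $ r)"
    using hess_elim_pivoted[OF piv v order.refl] unfolding w_def by blast+
  have p: "\<And>i. i < N \<Longrightarrow> p i < N" using piv by (auto simp: pivoted_family_def)
  have p'_old: "p' i = p i" if "i \<le> s" for i
    using that i0 by (auto simp: p' swap_entries_def)
  have p'_new: "p' (Suc s) = p i0" by (auto simp: p' swap_entries_def)
  have dS_carrier: "d (Suc s) \<in> carrier_vec N" using elim(1) dS by auto
  have dS_new: "d (Suc s) $ p' (Suc s) = 1"
    using p[OF i0(2)] elim(1) h hS by (simp add: dS p'_new)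
  have dS_old: "d (Suc s) $ p' i = 0" if "i \<le> s" for i
    using that elim(1) elim(2)[of i] p[of i] i0 by (simp add: dS p'_old)
  show "pivoted_family N (Suc (Suc s)) d p'"
    unfolding pivoted_family_def
  proof (intro conjI allI impI)
    show "p' i < N" if "i < N" for i using p that i0 by (auto simp: p' swap_entries_def)
    show "Suc (Suc s) \<le> N" using i0 by simp
    fix i
    assume i: "i < Suc (Suc s)"
    show "d i \<in> carrier_vec N" "d i $ p' i = 1"
      using i piv dS_carrier dS_new p'_old
      by (cases "i = Suc s"; auto simp: pivoted_family_def)+
    show "d i' $ p' i = 0" if "i < i' \<and> i' < Suc (Suc s)" for i'
      using that piv dS_old p'_old
      by (cases "i' = Suc s") (auto simp: pivoted_family_def)
  qed
  assume r: "r < N"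
  have "v $ r = w $ r + (\<Sum>i<Suc s. hess_elim d p v i $ p i * d i $ r)"
    using elim(3)[OF r] by simp
  also have "w $ r = d (Suc s) $ r * h (Suc s)" using r elim(1) h by (simp add: dS)
  also have "(\<Sum>i<Suc s. hess_elim d p v i $ p i * d i $ r) = (\<Sum>i<Suc s. d i $ r * h i)"
    using hi by (intro sum.cong) auto
  finally show "v $ r = (\<Sum>i<Suc (Suc s). d i $ r * h i)" by simp
qed

text \<open>
  One side of the simultaneous process. The other side enters only through the vectors \<open>v s\<close> to
  be reduced, so the two sides can be treated separately although each feeds the other.
\<close>

lemma hessenberg_pivoted:
  assumes init: "hess_init N b \<beta> (d 0) (p 0)" and b: "b \<in> carrier_vec N" "b \<noteq> 0\<^sub>v N"
    and steps: "\<And>s. s < k \<Longrightarrow> hess_step N s (v s) d (\<lambda>i. h i s) (p s) (p (Suc s))"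
    and v: "\<And>s. s < k \<Longrightarrow> v s \<in> carrier_vec N"
    and h: "\<And>s. s < k \<Longrightarrow> h (Suc s) s \<noteq> 0"
  shows "s \<le> k \<Longrightarrow> pivoted_family N (Suc s) d (p s)"
    and "s < k \<Longrightarrow> r < N \<Longrightarrow> v s $ r = (\<Sum>i<Suc (Suc s). d i $ r * h i s)"
proof -
  show *: "pivoted_family N (Suc s) d (p s)" if "s \<le> k" for s
    using that
  proof (induction s)
    case 0
    show ?case using hess_init_pivoted(1)[of N b \<beta> d "p 0", OF init b] by simp
  next
    case (Suc s)
    then show ?case
      using hess_step_pivoted(1)[of N s d "p s" "v s" "\<lambda>i. h i s" "p (Suc s)"] steps v h by simp
  qed
  show "v s $ r = (\<Sum>i<Suc (Suc s). d i $ r * h i s)" if "s < k" "r < N"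
    using that hess_step_pivoted(2)[of N s d "p s" "v s" "\<lambda>i. h i s" "p (Suc s)" r] * steps v h by simp
qed

section \<open>The block basis and the projected matrix\<close>

lemma sum_even_odd:
  fixes F :: "nat \<Rightarrow> real"
  shows "(\<Sum>i<2 * j. F i) = (\<Sum>i<j. F (2 * i)) + (\<Sum>i<j. F (2 * i + 1))"
  by (induction j) (simp_all add: algebra_simps)

lemma W_mat_carrier: "W_mat m n d l j \<in> carrier_mat (m + n) (2 * j)"
  by (rule carrier_matI) (simp_all add: W_mat_def)

lemma W_mat_index:
  assumes "i < j" "d i \<in> carrier_vec m" "l i \<in> carrier_vec n" "r < m + n"
  shows "W_mat m n d l j $$ (r, 2 * i) = (if r < m then d i $ r else 0)"
    and "W_mat m n d l j $$ (r, 2 * i + 1) = (if r < m then 0 else l i $ (r - m))"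
  using assms by (auto simp: W_mat_def mat_of_cols_index)

lemma col_W_mat:
  assumes "i < j" "d i \<in> carrier_vec m" "l i \<in> carrier_vec n"
  shows "col (W_mat m n d l j) (2 * i) = d i @\<^sub>v 0\<^sub>v n"
    and "col (W_mat m n d l j) (2 * i + 1) = 0\<^sub>v m @\<^sub>v l i"
  using assms by (auto simp: W_mat_def)

text \<open>
  Separating even and odd column indices undoes the interleaving of the two bases: the even
  entries of \<open>x\<close> are the coefficients of the family \<open>d\<close>, the odd ones those of \<open>l\<close>.
\<close>

lemma W_mat_mult_vec:
  assumes "\<And>i. i < j \<Longrightarrow> d i \<in> carrier_vec m" "\<And>i. i < j \<Longrightarrow> l i \<in> carrier_vec n"
    and x: "x \<in> carrier_vec (2 * j)" and r: "r < m + n"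
  shows "(W_mat m n d l j *\<^sub>v x) $ r =
    (if r < m then (\<Sum>i<j. d i $ r * x $ (2 * i)) else (\<Sum>i<j. l i $ (r - m) * x $ (2 * i + 1)))"
proof -
  have "(W_mat m n d l j *\<^sub>v x) $ r = (\<Sum>t<2 * j. W_mat m n d l j $$ (r, t) * x $ t)"
    using x r carrier_matD[OF W_mat_carrier[of m n d l j]]
    by (simp add: scalar_prod_def lessThan_atLeast0)
  also have "\<dots> = (if r < m then (\<Sum>i<j. d i $ r * x $ (2 * i))
                  else (\<Sum>i<j. l i $ (r - m) * x $ (2 * i + 1)))"
    unfolding sum_even_odd using assms W_mat_index[of _ j d m l n r]
    by simp
  finally show ?thesis .
qed

lemma W_mat_injective:
  assumes d: "pivoted_family m j d p" and l: "pivoted_family n j l q"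
    and x: "x \<in> carrier_vec (2 * j)" and zero: "W_mat m n d l j *\<^sub>v x = 0\<^sub>v (m + n)"
  shows "x = 0\<^sub>v (2 * j)"
proof (rule eq_vecI)
  have carrier: "\<And>i. i < j \<Longrightarrow> d i \<in> carrier_vec m" "\<And>i. i < j \<Longrightarrow> l i \<in> carrier_vec n"
    using d l by (auto simp: pivoted_family_def)
  have mv: "(if r < m then (\<Sum>i<j. d i $ r * x $ (2 * i))
      else (\<Sum>i<j. l i $ (r - m) * x $ (2 * i + 1))) = 0" if "r < m + n" for r
    using W_mat_mult_vec[of j d m l n x r] carrier x zero that by simp
  have even: "x $ (2 * i) = 0" if "i < j" for i
  proof (rule pivoted_family_independent[OF d _ that, of "\<lambda>i. x $ (2 * i)"])
    fix r
    assume "r < m"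
    then show "(\<Sum>i<j. d i $ r * x $ (2 * i)) = 0" using mv[of r] by simp
  qed
  have odd: "x $ (2 * i + 1) = 0" if "i < j" for i
  proof (rule pivoted_family_independent[OF l _ that, of "\<lambda>i. x $ (2 * i + 1)"])
    fix r
    assume "r < n"
    then show "(\<Sum>i<j. l i $ r * x $ (2 * i + 1)) = 0" using mv[of "m + r"] by simp
  qed
  fix t
  assume "t < dim_vec (0\<^sub>v (2 * j) :: real vec)"
  then have t: "t < 2 * j" by simp
  show "x $ t = 0\<^sub>v (2 * j) $ t"
  proof (cases "even t")
    case True
    then show ?thesis using even t by (auto elim!: evenE)
  next
    case False
    then show ?thesis using odd t by (auto elim!: oddE)
  qed
qed (use x in simp)

lemma W_mat_mult_rhs:
  assumes carrier: "\<And>i. i < Suc k \<Longrightarrow> d i \<in> carrier_vec m" "\<And>i. i < Suc k \<Longrightarrow> l i \<in> carrier_vec n"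
    and b: "\<beta> \<cdot>\<^sub>v d 0 = b" and c: "\<gamma> \<cdot>\<^sub>v l 0 = c"
  shows "W_mat m n d l (Suc k) *\<^sub>v
      (\<beta> \<cdot>\<^sub>v unit_vec (2 * k + 2) 0 + \<gamma> \<cdot>\<^sub>v unit_vec (2 * k + 2) 1) = b @\<^sub>v c"
    (is "?W *\<^sub>v ?e = _")
proof (rule eq_vecI)
  have d0: "d 0 \<in> carrier_vec m" and l0: "l 0 \<in> carrier_vec n" using carrier by auto
  show "dim_vec (?W *\<^sub>v ?e) = dim_vec (b @\<^sub>v c)"
    using d0 l0 b c carrier_matD[OF W_mat_carrier[of m n d l "Suc k"]] by auto
  have e: "?e \<in> carrier_vec (2 * Suc k)" by simp
  have even: "?e $ (2 * i) = (if i = 0 then \<beta> else 0)" if "i < Suc k" for i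
    using that by auto
  have odd: "?e $ (2 * i + 1) = (if i = 0 then \<gamma> else 0)" if "i < Suc k" for i
    using that by auto
  fix r
  assume "r < dim_vec (b @\<^sub>v c)"
  then have r: "r < m + n" using d0 l0 b c by auto
  have "(?W *\<^sub>v ?e) $ r = (if r < m then (\<Sum>i<Suc k. d i $ r * ?e $ (2 * i))
      else (\<Sum>i<Suc k. l i $ (r - m) * ?e $ (2 * i + 1)))"
    by (rule W_mat_mult_vec[of "Suc k" d m l n, OF carrier e r])
  also have "(\<Sum>i<Suc k. d i $ r * ?e $ (2 * i)) = (\<Sum>i<Suc k. if i = 0 then d 0 $ r * \<beta> else 0)"
    using even by (intro sum.cong) auto
  also have "(\<Sum>i<Suc k. l i $ (r - m) * ?e $ (2 * i + 1)) =
      (\<Sum>i<Suc k. if i = 0 then l 0 $ (r - m) * \<gamma> else 0)"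
    using odd by (intro sum.cong) auto
  finally show "(?W *\<^sub>v ?e) $ r = (b @\<^sub>v c) $ r"
    using r d0 l0 by (auto simp: b[symmetric] c[symmetric])
qed

lemma S_mat_carrier: "S_mat lam mu h f k \<in> carrier_mat (2 * Suc k) (2 * k)"
  by (simp add: S_mat_def)

lemma S_mat_col:
  assumes "j < k" "i < Suc k"
  shows "col (S_mat lam mu h f k) (2 * j) $ (2 * i) = (if i = j then lam else 0)"
    and "col (S_mat lam mu h f k) (2 * j) $ (2 * i + 1) = (if i < Suc (Suc j) then f i j else 0)"
    and "col (S_mat lam mu h f k) (2 * j + 1) $ (2 * i) = (if i < Suc (Suc j) then h i j else 0)"
    and "col (S_mat lam mu h f k) (2 * j + 1) $ (2 * i + 1) = (if i = j then mu else 0)"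
  using assms by (auto simp: S_mat_def Let_def)

text \<open>
  The projected matrix is zero below its block subdiagonal, so a sum over a full column shortens
  to the range of the Hessenberg relation.
\<close>

lemma sum_truncate:
  fixes F :: "nat \<Rightarrow> real"
  assumes "t \<le> N"
  shows "(\<Sum>i<N. g i * (if i < t then F i else 0)) = (\<Sum>i<t. g i * F i)"
  using assms by (intro sum.mono_neutral_cong_right) auto

lemma K_mat_carrier:
  "A \<in> carrier_mat m n \<Longrightarrow> B \<in> carrier_mat n m \<Longrightarrow> K_mat lam mu A B \<in> carrier_mat (m + n) (m + n)"
  by (auto simp: K_mat_def)

lemma K_mat_mult_append:
  assumes A: "A \<in> carrier_mat m n" and B: "B \<in> carrier_mat n m"
    and a: "a \<in> carrier_vec m" and c: "c \<in> carrier_vec n"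
  shows "K_mat lam mu A B *\<^sub>v (a @\<^sub>v c) = (lam \<cdot>\<^sub>v a + A *\<^sub>v c) @\<^sub>v (B *\<^sub>v a + mu \<cdot>\<^sub>v c)"
proof -
  have sm: "(t \<cdot>\<^sub>m 1\<^sub>m N) *\<^sub>v v = t \<cdot>\<^sub>v v" if "v \<in> carrier_vec N" for t N and v :: "real vec"
    using that by (intro eq_vecI) auto
  show ?thesis
    unfolding K_mat_def using assms
    by (subst four_block_mat_mult_vec
        [where ?nr1.0 = m and ?nc1.0 = m and ?nc2.0 = n and ?nr2.0 = n]) (auto simp: sm)
qed

text \<open>
  Columns are compared one at a time. An even column of \<open>W\<^sub>k\<close> is \<open>(d\<^sub>j, 0)\<close>, which \<open>K\<close> maps to
  \<open>(lam d\<^sub>j, B d\<^sub>j)\<close>: the first component gives the diagonal entry \<open>lam\<close> of \<open>S\<close>, and the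
  expansion of \<open>B d\<^sub>j\<close> in the family \<open>l\<close> gives the entries \<open>f i j\<close>. Odd columns are
  symmetric.
\<close>

lemma K_W_eq_W_S:
  assumes A: "A \<in> carrier_mat m n" and B: "B \<in> carrier_mat n m"
    and d: "\<And>i. i < Suc k \<Longrightarrow> d i \<in> carrier_vec m" and l: "\<And>i. i < Suc k \<Longrightarrow> l i \<in> carrier_vec n"
    and Al: "\<And>s r. s < k \<Longrightarrow> r < m \<Longrightarrow> (A *\<^sub>v l s) $ r = (\<Sum>i<Suc (Suc s). d i $ r * h i s)"
    and Bd: "\<And>s r. s < k \<Longrightarrow> r < n \<Longrightarrow> (B *\<^sub>v d s) $ r = (\<Sum>i<Suc (Suc s). l i $ r * f i s)"
  shows "K_mat lam mu A B * W_mat m n d l k = W_mat m n d l (Suc k) * S_mat lam mu h f k"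
    (is "?K * ?W = ?W' * ?S")
proof (rule mat_col_eqI)
  note K = K_mat_carrier[OF A B, of lam mu]
  have W: "?W \<in> carrier_mat (m + n) (2 * k)" and W': "?W' \<in> carrier_mat (m + n) (2 * Suc k)"
    and S: "?S \<in> carrier_mat (2 * Suc k) (2 * k)" by (rule W_mat_carrier S_mat_carrier)+
  show "dim_row (?K * ?W) = dim_row (?W' * ?S)" "dim_col (?K * ?W) = dim_col (?W' * ?S)"
    using K W W' S by auto
  fix t
  assume "t < dim_col (?W' * ?S)"
  then have t: "t < 2 * k" using S by auto
  have colS: "col ?S t \<in> carrier_vec (2 * Suc k)" using S t by auto
  have W'S: "(?W' *\<^sub>v col ?S t) $ r =
      (if r < m then (\<Sum>i<Suc k. d i $ r * col ?S t $ (2 * i))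
       else (\<Sum>i<Suc k. l i $ (r - m) * col ?S t $ (2 * i + 1)))" if "r < m + n" for r
    by (rule W_mat_mult_vec[of "Suc k" d m l n, OF d l colS that])
  have "?K *\<^sub>v col ?W t = ?W' *\<^sub>v col ?S t"
  proof (rule eq_vecI)
    show "dim_vec (?K *\<^sub>v col ?W t) = dim_vec (?W' *\<^sub>v col ?S t)" using K W' by simp
    fix r
    assume "r < dim_vec (?W' *\<^sub>v col ?S t)"
    then have r: "r < m + n" using W' by simp
    show "(?K *\<^sub>v col ?W t) $ r = (?W' *\<^sub>v col ?S t) $ r"
    proof (cases "even t")
      case True
      then obtain j where j: "t = 2 * j" "j < k" using t by (auto elim!: evenE)
      have dj: "d j \<in> carrier_vec m" and lj: "l j \<in> carrier_vec n" using d l j by auto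
      have zero: "A *\<^sub>v 0\<^sub>v n = 0\<^sub>v m" using A by auto
      have "?K *\<^sub>v col ?W t = (lam \<cdot>\<^sub>v d j) @\<^sub>v (B *\<^sub>v d j)"
        unfolding j(1) col_W_mat(1)[of j k d m l n, OF j(2) dj lj]
        using dj B by (subst K_mat_mult_append[OF A B]) (auto simp: zero)
      moreover have "(\<Sum>i<Suc k. d i $ r * col ?S t $ (2 * i)) = lam * d j $ r"
      proof -
        have "(\<Sum>i<Suc k. d i $ r * col ?S t $ (2 * i)) = (\<Sum>i<Suc k. if i = j then lam * d j $ r else 0)"
          using j by (intro sum.cong) (auto simp: S_mat_col)
        then show ?thesis using j by simp
      qed
      moreover have "(\<Sum>i<Suc k. l i $ (r - m) * col ?S t $ (2 * i + 1)) = (B *\<^sub>v d j) $ (r - m)"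
        if "\<not> r < m"
      proof -
        have "(\<Sum>i<Suc k. l i $ (r - m) * col ?S t $ (2 * i + 1)) =
            (\<Sum>i<Suc k. l i $ (r - m) * (if i < Suc (Suc j) then f i j else 0))"
          unfolding j(1) using j by (intro sum.cong refl) (simp only: S_mat_col lessThan_iff)
        then show ?thesis using Bd[of j "r - m"] j r that by (simp only: sum_truncate)
      qed
      ultimately show ?thesis using W'S[OF r] r dj B by auto
    next
      case False
      then obtain j where j: "t = 2 * j + 1" "j < k" using t by (auto elim!: oddE)
      have dj: "d j \<in> carrier_vec m" and lj: "l j \<in> carrier_vec n" using d l j by auto
      have zero: "B *\<^sub>v 0\<^sub>v m = 0\<^sub>v n" using B by auto
      have "?K *\<^sub>v col ?W t = (A *\<^sub>v l j) @\<^sub>v (mu \<cdot>\<^sub>v l j)"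
        unfolding j(1) col_W_mat(2)[of j k d m l n, OF j(2) dj lj]
        using lj A by (subst K_mat_mult_append[OF A B]) (auto simp: zero)
      moreover have "(\<Sum>i<Suc k. l i $ (r - m) * col ?S t $ (2 * i + 1)) = mu * l j $ (r - m)"
      proof -
        have "(\<Sum>i<Suc k. l i $ (r - m) * col ?S t $ (2 * i + 1)) =
            (\<Sum>i<Suc k. if i = j then mu * l j $ (r - m) else 0)"
          unfolding j(1) using j by (intro sum.cong refl) (simp only: S_mat_col lessThan_iff, simp)
        then show ?thesis using j by simp
      qed
      moreover have "(\<Sum>i<Suc k. d i $ r * col ?S t $ (2 * i)) = (A *\<^sub>v l j) $ r" if "r < m"
      proof -
        have "(\<Sum>i<Suc k. d i $ r * col ?S t $ (2 * i)) =
            (\<Sum>i<Suc k. d i $ r * (if i < Suc (Suc j) then h i j else 0))"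
          unfolding j(1) using j by (intro sum.cong refl) (simp only: S_mat_col lessThan_iff)
        then show ?thesis using Al[of j r] j that by (simp only: sum_truncate)
      qed
      ultimately show ?thesis using W'S[OF r] r lj A by auto
    qed
  qed
  then show "col (?K * ?W) t = col (?W' * ?S) t"
    using col_mult2[OF K W t] col_mult2[OF W' S t] by simp
qed

section \<open>Comparison of the residuals\<close>

text \<open>
  Measuring coefficient vectors instead of their images under \<open>W\<close> costs at most the condition
  number: \<open>\<parallel>W\<parallel>\<close> bounds the growth from \<open>x\<close> to \<open>W x\<close>, and the norm of the left inverse \<open>W\<^sup>\<dagger>\<close>
  bounds the growth from \<open>W y\<close> back to \<open>y\<close>.
\<close>

lemma quasi_minimal_residual_bound:
  assumes W: "W \<in> carrier_mat N M"
    and inj: "\<And>x. x \<in> carrier_vec M \<Longrightarrow> W *\<^sub>v x = 0\<^sub>v N \<Longrightarrow> x = 0\<^sub>v M"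
    and x: "x \<in> carrier_vec M" and y: "y \<in> carrier_vec M" and le: "vnorm x \<le> vnorm y"
  shows "vnorm (W *\<^sub>v x) \<le> cond_number W * vnorm (W *\<^sub>v y)"
proof -
  note P = pinv_left_inverse[OF W inj]
  have "y = pinv W *\<^sub>v (W *\<^sub>v y)"
    using assoc_mult_mat_vec[OF P(1) W y] P(2) y by simp
  then have "vnorm y \<le> spectral_norm (pinv W) * vnorm (W *\<^sub>v y)"
    using vnorm_mult_mat_vec_le[of "W *\<^sub>v y" "pinv W"] P(1) W y by auto
  then have "spectral_norm W * vnorm x \<le> spectral_norm W * (spectral_norm (pinv W) * vnorm (W *\<^sub>v y))"
    using le spectral_norm_nonneg by (intro mult_left_mono) auto
  moreover have "vnorm (W *\<^sub>v x) \<le> spectral_norm W * vnorm x"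
    using W x by (intro vnorm_mult_mat_vec_le) auto
  ultimately show ?thesis by (simp add: cond_number_def mult.assoc)
qed

theorem theorem6:
  fixes m n k :: nat
    and A B :: "real mat" and b c :: "real vec" and lam mu \<beta> \<gamma> :: real
    and p q :: "nat \<Rightarrow> nat \<Rightarrow> nat" and d l :: "nat \<Rightarrow> real vec"
    and h f :: "nat \<Rightarrow> nat \<Rightarrow> real"
    and r_gpcmrh r_gpmr :: "real vec"
  assumes "A \<in> carrier_mat m n" and "B \<in> carrier_mat n m"
    and "b \<in> carrier_vec m" and "c \<in> carrier_vec n"
    and "b \<noteq> 0\<^sub>v m" and "c \<noteq> 0\<^sub>v n"
    and "k \<ge> 1"
    and "simultaneous_hessenberg A B b c k \<beta> \<gamma> p q d l h f"
    and "not_terminated m n k h f"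
    and "is_gpcmrh_residual (K_mat lam mu A B) (b @\<^sub>v c) (W_mat m n d l k)
           (S_mat lam mu h f k) \<beta> \<gamma> k r_gpcmrh"
    and "is_gpmr_residual (K_mat lam mu A B) (b @\<^sub>v c) (W_mat m n d l k) k r_gpmr"
  shows "vnorm r_gpmr \<le> vnorm r_gpcmrh \<and>
         vnorm r_gpcmrh \<le> cond_number (W_mat m n d l (k + 1)) * vnorm r_gpmr"
proof -
  note A = assms(1) and B = assms(2) and b = assms(3) and c = assms(4)
  have init_d: "hess_init m b \<beta> (d 0) (p 0)" and init_l: "hess_init n c \<gamma> (l 0) (q 0)"
    and steps_d: "\<And>s. s < k \<Longrightarrow> hess_step m s (A *\<^sub>v l s) d (\<lambda>i. h i s) (p s) (p (Suc s))"
    and steps_l: "\<And>s. s < k \<Longrightarrow> hess_step n s (B *\<^sub>v d s) l (\<lambda>i. f i s) (q s) (q (Suc s))"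
    using assms(8) b c by (auto simp: simultaneous_hessenberg_def)
  have h: "\<And>s. s < k \<Longrightarrow> h (Suc s) s \<noteq> 0" and f: "\<And>s. s < k \<Longrightarrow> f (Suc s) s \<noteq> 0"
    using assms(9) by (auto simp: not_terminated_def)
  have Al: "A *\<^sub>v l s \<in> carrier_vec m" and Bd: "B *\<^sub>v d s \<in> carrier_vec n" for s
    using A B by (auto intro!: carrier_vecI)
  note hess_d = hessenberg_pivoted[of m b \<beta> d p k "\<lambda>s. A *\<^sub>v l s" h, OF init_d b assms(5) steps_d Al h]
  note hess_l = hessenberg_pivoted[of n c \<gamma> l q k "\<lambda>s. B *\<^sub>v d s" f, OF init_l c assms(6) steps_l Bd f]
  have piv_d: "pivoted_family m (Suc k) d (p k)" and piv_l: "pivoted_family n (Suc k) l (q k)"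
    using hess_d(1) hess_l(1) by simp_all
  have d: "\<And>i. i < Suc k \<Longrightarrow> d i \<in> carrier_vec m" and l: "\<And>i. i < Suc k \<Longrightarrow> l i \<in> carrier_vec n"
    using piv_d piv_l by (auto simp: pivoted_family_def)
  define W where "W = W_mat m n d l (Suc k)"
  define e where "e = \<beta> \<cdot>\<^sub>v unit_vec (2 * k + 2) 0 + \<gamma> \<cdot>\<^sub>v unit_vec (2 * k + 2) (1 :: nat)"
  let ?K = "K_mat lam mu A B" and ?Wk = "W_mat m n d l k" and ?S = "S_mat lam mu h f k"
  note K = K_mat_carrier[OF A B, of lam mu]
  have Wk: "?Wk \<in> carrier_mat (m + n) (2 * k)" and W: "W \<in> carrier_mat (m + n) (2 * Suc k)"
    and S: "?S \<in> carrier_mat (2 * Suc k) (2 * k)" and e: "e \<in> carrier_vec (2 * Suc k)"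
    unfolding W_def e_def by (rule W_mat_carrier S_mat_carrier | simp)+
  have inj: "x = 0\<^sub>v (2 * Suc k)" if "x \<in> carrier_vec (2 * Suc k)" "W *\<^sub>v x = 0\<^sub>v (m + n)" for x
    using W_mat_injective[OF piv_d piv_l that[unfolded W_def]] .
  have KW: "?K * ?Wk = W * ?S"
    unfolding W_def using hess_d(2) hess_l(2) by (intro K_W_eq_W_S[OF A B d l]) auto
  have We: "W *\<^sub>v e = b @\<^sub>v c"
    unfolding W_def e_def
    using hess_init_pivoted(2)[of m b \<beta> d "p 0", OF init_d b assms(5)]
      hess_init_pivoted(2)[of n c \<gamma> l "q 0", OF init_l c assms(6)]
    by (intro W_mat_mult_rhs[OF d l]) auto
  have residual: "(b @\<^sub>v c) - ?K *\<^sub>v (?Wk *\<^sub>v z) = W *\<^sub>v (e - ?S *\<^sub>v z)"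
    if z: "z \<in> carrier_vec (2 * k)" for z
  proof -
    have "?K *\<^sub>v (?Wk *\<^sub>v z) = W *\<^sub>v (?S *\<^sub>v z)"
      using assoc_mult_mat_vec[OF K Wk z] assoc_mult_mat_vec[OF W S z] KW by simp
    then show ?thesis
      using mult_minus_distrib_mat_vec[OF W e, of "?S *\<^sub>v z"] S z We by simp
  qed
  obtain zC where zC: "zC \<in> carrier_vec (2 * k)"
    and minC: "\<And>z. z \<in> carrier_vec (2 * k) \<Longrightarrow> vnorm (e - ?S *\<^sub>v zC) \<le> vnorm (e - ?S *\<^sub>v z)"
    and rC: "r_gpcmrh = (b @\<^sub>v c) - ?K *\<^sub>v (?Wk *\<^sub>v zC)"
    using assms(10) unfolding is_gpcmrh_residual_def e_def[symmetric] is_arg_min_linorder by auto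
  obtain zG where zG: "zG \<in> carrier_vec (2 * k)"
    and minG: "\<And>z. z \<in> carrier_vec (2 * k) \<Longrightarrow>
      vnorm ((b @\<^sub>v c) - ?K *\<^sub>v (?Wk *\<^sub>v zG)) \<le> vnorm ((b @\<^sub>v c) - ?K *\<^sub>v (?Wk *\<^sub>v z))"
    and rG: "r_gpmr = (b @\<^sub>v c) - ?K *\<^sub>v (?Wk *\<^sub>v zG)"
    using assms(11) unfolding is_gpmr_residual_def is_arg_min_linorder by auto
  have "vnorm r_gpcmrh \<le> cond_number W * vnorm r_gpmr"
    unfolding rC rG residual[OF zC] residual[OF zG]
    using S e zC zG minC[OF zG] by (intro quasi_minimal_residual_bound[OF W inj]) auto
  moreover have "vnorm r_gpmr \<le> vnorm r_gpcmrh" unfolding rC rG by (rule minG[OF zC])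
  ultimately show ?thesis by (simp add: W_def)
qed

end
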